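(* The basis $(P_\Phi)$ of $\mathrm{NCQSym}$ refines the symmetric powersum functions of $\mathrm{NCSym}$: for every set partition $\phi$ of $[n]$, $$p_\phi=\sum_{\Phi:\ \mathsf{sort}(\Phi)=\phi}P_\Phi ,$$ the sum being over all set compositions $\Phi$ of $[n]$ whose underlying set partition is $\phi$.
   Context: A set partition of $[n]$ is an unordered collection of disjoint nonempty blocks with union $[n]$; $\phi\le\psi$ means that every block of $\psi$ is a union of blocks of $\phi$. A set composition $\Phi=(B_1,\dots,B_k)=B_1|\cdots|B_k$ is an ordered set partition; $\mathsf{sort}(\Phi)$ is its underlying (unordered) set partition. In formal power series in noncommuting variables $x_1,x_2,\dots$: $m_\phi=\sum x_{i_1}\cdots x_{i_n}$, over all $(i_1,\dots,i_n)$ such that $i_j=i_{j'}$ if and only if $j,j'$ lie in the same block of $\phi$; the symmetric powersum function in noncommuting variables is $p_\phi=\sum_{\phi\le\psi}m_\psi$. The monomial basis of $\mathrm{NCQSym}$ is $M_\Phi=\sum x_{a_1}\cdots x_{a_n}$, over all words $(a_1,\dots,a_n)$ of positive integers with exactly $k$ distinct letters such that $B_j=\{i:a_i\text{ is the }j\text{-th smallest distinct letter}\}$. Thus $m_\phi=\sum_{\mathsf{sort}(\Phi)=\phi}M_\Phi$, which embeds $\mathrm{NCSym}$ in $\mathrm{NCQSym}$. For disjoint nonempty sets of positive integers, $A>_{\widetilde{D}}B$ if and only if $|A|>|B|$, or $|A|=|B|$ and $\min(A)<\min(B)$. For $\Phi=(B_1,\dots,B_k)$, $P_\Phi=\sum_\Psi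 M_\Psi$, the sum over all set compositions $\Psi$ obtained from $\Phi$ by choosing a subset $I$ of $\{i<k: B_i>_{\widetilde D}B_{i+1}\}$ and merging (by union) $B_i$ and $B_{i+1}$ into the same block for every $i\in I$. For example $P_{14|2|3}=M_{14|2|3}+M_{124|3}+M_{14|23}+M_{1234}$. *)

theory Defs
  imports Complex_Main "HOL-Library.Disjoint_Sets" "HOL-Library.Function_Algebras"
begin

text \<open>
  A formal power series in the noncommuting variables \<open>x\<^sub>1, x\<^sub>2, \<dots>\<close> is represented by
  its coefficient function: the word \<open>[i\<^sub>1, \<dots>, i\<^sub>n]\<close> of positive integers is sent to the
  coefficient of \<open>x\<^bsub>i\<^sub>1\<^esub> \<cdots> x\<^bsub>i\<^sub>n\<^esub>\<close>. Words containing the letter 0 carry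
  coefficient 0 in all series below. Addition of series is the pointwise addition of
  \<open>Function_Algebras\<close>; the pointwise product of that theory is not the product of series
  and is never used.
\<close>

type_synonym 'r ncseries = "nat list \<Rightarrow> 'r"

definition words :: "nat \<Rightarrow> nat list set" where
  "words n = {w. length w = n \<and> (\<forall>a \<in> set w. 0 < a)}"

definition refines_partition :: "nat set set \<Rightarrow> nat set set \<Rightarrow> bool" where
  "refines_partition \<phi> \<psi> \<longleftrightarrow> (\<forall>B \<in> \<psi>. \<exists>S \<subseteq> \<phi>. B = \<Union>S)"

text \<open>Positions in a word are counted from 1, hence \<open>w ! (j - 1)\<close> for the \<open>j\<close>-th letter.\<close>

definition m_nc :: "nat \<Rightarrow> nat set set \<Rightarrow> 'r::comm_ring_1 ncseries" where
  "m_nc n \<phi> = (\<lambda>w. of_bool (w \<in> words n \<and>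
     (\<forall>j \<in> {1..n}. \<forall>j' \<in> {1..n}.
        w ! (j - 1) = w ! (j' - 1) \<longleftrightarrow> (\<exists>B \<in> \<phi>. j \<in> B \<and> j' \<in> B))))"

definition p_nc :: "nat \<Rightarrow> nat set set \<Rightarrow> 'r::comm_ring_1 ncseries" where
  "p_nc n \<phi> = (\<Sum>\<psi> \<in> {\<psi>. partition_on {1..n} \<psi> \<and> refines_partition \<phi> \<psi>}. m_nc n \<psi>)"

text \<open>The underlying set partition of a set composition \<open>\<Phi>\<close> is \<open>set \<Phi>\<close>.\<close>

definition set_composition :: "nat \<Rightarrow> nat set list \<Rightarrow> bool" where
  "set_composition n \<Phi> \<longleftrightarrow> distinct \<Phi> \<and> partition_on {1..n} (set \<Phi>)"

text \<open>
  Blocks are indexed from 0, so \<open>\<Phi> ! j\<close> collects the positions of the letter at index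
  \<open>j\<close> in the increasing enumeration of the distinct letters of the word.
\<close>

definition M_nc :: "nat \<Rightarrow> nat set list \<Rightarrow> 'r::comm_ring_1 ncseries" where
  "M_nc n \<Phi> = (\<lambda>w. of_bool (w \<in> words n \<and> card (set w) = length \<Phi> \<and>
     (\<forall>j < length \<Phi>. \<Phi> ! j = {i \<in> {1..n}. w ! (i - 1) = sorted_list_of_set (set w) ! j})))"

definition gt_D :: "nat set \<Rightarrow> nat set \<Rightarrow> bool" where
  "gt_D A B \<longleftrightarrow> card A > card B \<or> (card A = card B \<and> Min A < Min B)"

definition descents_D :: "nat set list \<Rightarrow> nat set" where
  "descents_D \<Phi> = {i. Suc i < length \<Phi> \<and> gt_D (\<Phi> ! i) (\<Phi> ! Suc i)}"

text \<open>
  \<open>merge_at k I \<Phi>\<close> merges, for every \<open>i \<in> I\<close>, the blocks with indices \<open>i\<close> and \<open>i + 1\<close>.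
  The argument \<open>k\<close> is the index, in the original composition, of the last block already
  absorbed into the head of the list; at the outset \<open>k = 0\<close>.
\<close>

fun merge_at :: "nat \<Rightarrow> nat set \<Rightarrow> nat set list \<Rightarrow> nat set list" where
  "merge_at k I [] = []"
| "merge_at k I [B] = [B]"
| "merge_at k I (B # C # \<Phi>) =
     (if k \<in> I then merge_at (Suc k) I ((B \<union> C) # \<Phi>)
      else B # merge_at (Suc k) I (C # \<Phi>))"

definition P_nc :: "nat \<Rightarrow> nat set list \<Rightarrow> 'r::comm_ring_1 ncseries" where
  "P_nc n \<Phi> = (\<Sum>\<Psi> \<in> {merge_at 0 I \<Phi> | I. I \<subseteq> descents_D \<Phi>}. M_nc n \<Psi>)"

text \<open>The index sets of all sums involved are finite.\<close>

lemma finite_coarser_partitions: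
  "finite {\<psi>. partition_on {1..n} \<psi> \<and> refines_partition \<phi> \<psi>}"
  by (rule finite_subset[OF _ finitely_many_partition_on[of "{1..n}"]]) auto

lemma finite_mergings: "finite {merge_at 0 I \<Phi> | I. I \<subseteq> descents_D \<Phi>}"
proof -
  have "finite (descents_D \<Phi>)"
    by (rule finite_subset[of _ "{..<length \<Phi>}"]) (auto simp: descents_D_def)
  moreover have "{merge_at 0 I \<Phi> | I. I \<subseteq> descents_D \<Phi>} =
      (\<lambda>I. merge_at 0 I \<Phi>) ` Pow (descents_D \<Phi>)"
    by auto
  ultimately show ?thesis
    by simp
qed

lemma finite_set_compositions: "finite {\<Phi>. set_composition n \<Phi> \<and> set \<Phi> = \<phi>}"
proof (cases "finite \<phi>")
  case True
  show ?thesis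
    by (rule finite_subset[OF _ finite_subset_distinct[OF True]])
      (auto simp: set_composition_def)
next
  case False
  then have "\<not> set \<Phi> = \<phi>" for \<Phi>
    using finite_set by metis
  then show ?thesis
    by simp
qed

end

theory Submission
  imports Defs "HOL-Library.Product_Lexorder"
begin

text \<open>
  Compare the coefficients of a word \<open>w\<close>. The fibres of \<open>w\<close>, listed by increasing letter, form the
  only set composition whose monomial series contains \<open>w\<close>. Hence the coefficient in \<open>p_nc n \<phi>\<close> is 1
  or 0 according to whether \<open>w\<close> is constant on the blocks of \<open>\<phi>\<close>. The coefficient in \<open>P_nc n \<Phi>\<close> is 1
  exactly if, in addition, the blocks in \<open>\<Phi>\<close> appear by weakly increasing letter and each adjacent
  pair with equal letters is a descent, that is, if \<open>\<Phi>\<close> is strictly sorted for the lexicographic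
  combination of the letter order and \<open>gt_D\<close>. This is a strict linear order on the blocks of \<open>\<phi>\<close>, so
  exactly one arrangement of \<open>\<phi>\<close> qualifies.
\<close>

section \<open>Merging blocks and functions constant on them\<close>

definition constant_over :: "('a \<Rightarrow> 'b) \<Rightarrow> 'a set \<Rightarrow> bool" where
  "constant_over f B \<longleftrightarrow> (\<forall>x\<in>B. \<forall>y\<in>B. f x = f y)"

definition below_via :: "('a \<Rightarrow> 'b::linorder) \<Rightarrow> 'a set \<Rightarrow> 'a set \<Rightarrow> bool" where
  "below_via f B C \<longleftrightarrow> (\<forall>x\<in>B. \<forall>y\<in>C. f x < f y)"

text \<open>Only single blocks and adjacent pairs are constrained, so that the condition can be
  followed through \<open>merge_at\<close> one pair at a time. For nonempty blocks covering all
  positions it will characterise the fibre list of a word.\<close>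

definition strata :: "('a \<Rightarrow> 'b::linorder) \<Rightarrow> 'a set list \<Rightarrow> bool" where
  "strata f \<Phi> \<longleftrightarrow> (\<forall>B\<in>set \<Phi>. constant_over f B) \<and> successively (below_via f) \<Phi>"

lemma constant_overD: "constant_over f B \<Longrightarrow> x \<in> B \<Longrightarrow> y \<in> B \<Longrightarrow> f x = f y"
  unfolding constant_over_def by blast

lemma Union_merge_at: "\<Union>(set (merge_at k I \<Phi>)) = \<Union>(set \<Phi>)"
  by (induction k I \<Phi> rule: merge_at.induct) auto

lemma empty_notin_merge_at: "{} \<notin> set \<Phi> \<Longrightarrow> {} \<notin> set (merge_at k I \<Phi>)"
  by (induction k I \<Phi> rule: merge_at.induct) auto

text \<open>Gives access to the head of a merged tail, which an unmerged block before it must be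
  compared with.\<close>

lemma merge_at_Cons: "\<exists>D \<Psi>. merge_at k I (C # \<Phi>) = D # \<Psi> \<and> C \<subseteq> D"
proof (induction \<Phi> arbitrary: k C)
  case (Cons B \<Phi>)
  show ?case
    using Cons.IH[of "Suc k" "C \<union> B"] by auto
qed auto

lemma all_Suc_less_Suc:
  "(\<forall>i. Suc i < Suc (Suc m) \<longrightarrow> P i) \<longleftrightarrow> P 0 \<and> (\<forall>i. Suc i < Suc m \<longrightarrow> P (Suc i))"
  by (metis Suc_less_eq less_Suc_eq_0_disj)

text \<open>A merged pair must share its value and a separated pair must increase. Nonempty blocks
  carry the common value along a whole merged run, so conditions on the original adjacent pairs
  suffice. The current index \<open>i\<close> is index \<open>k + i\<close> of the original
  composition.\<close>

lemma strata_merge_at: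
  assumes "{} \<notin> set \<Phi>"
  shows "strata f (merge_at k I \<Phi>) \<longleftrightarrow> (\<forall>B\<in>set \<Phi>. constant_over f B) \<and>
    (\<forall>i. Suc i < length \<Phi> \<longrightarrow>
      (if k + i \<in> I then constant_over f (\<Phi> ! i \<union> \<Phi> ! Suc i)
       else below_via f (\<Phi> ! i) (\<Phi> ! Suc i)))"
  using assms
proof (induction k I \<Phi> rule: merge_at.induct)
  case (3 k I B C \<Phi>)
  show ?case
  proof (cases "k \<in> I")
    case True
    have ne: "{} \<notin> set ((B \<union> C) # \<Phi>)"
      using "3.prems" by auto
    have const: "constant_over f (B \<union> C) \<Longrightarrow> constant_over f B \<and> constant_over f C"
      by (auto simp: constant_over_def)
    have cong: "constant_over f (B \<union> C \<union> X) = constant_over f (C \<union> X)"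
      "below_via f (B \<union> C) X = below_via f C X" if "constant_over f (B \<union> C)" for X
    proof -
      obtain c where "c \<in> C" using 3 by auto
      then have "\<forall>x\<in>B \<union> C. f x = f c"
        using that unfolding constant_over_def by blast
      with \<open>c \<in> C\<close> show "constant_over f (B \<union> C \<union> X) = constant_over f (C \<union> X)"
        "below_via f (B \<union> C) X = below_via f C X"
        unfolding constant_over_def below_via_def by (metis Un_iff)+
    qed
    have "strata f (merge_at k I (B # C # \<Phi>)) \<longleftrightarrow> (\<forall>B\<in>set ((B \<union> C) # \<Phi>). constant_over f B) \<and>
      (\<forall>i. Suc i < length ((B \<union> C) # \<Phi>) \<longrightarrow>
      (if Suc k + i \<in> I then constant_over f (((B \<union> C) # \<Phi>) ! i \<union> ((B \<union> C) # \<Phi>) ! Suc i)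
       else below_via f (((B \<union> C) # \<Phi>) ! i) (((B \<union> C) # \<Phi>) ! Suc i)))"
      using "3.IH"(1)[OF True ne] True by (simp only: merge_at.simps if_True)
    also have "\<dots> \<longleftrightarrow> (\<forall>B\<in>set ((B \<union> C) # \<Phi>). constant_over f B) \<and>
      (\<forall>i. Suc i < length (C # \<Phi>) \<longrightarrow>
      (if Suc k + i \<in> I then constant_over f ((C # \<Phi>) ! i \<union> (C # \<Phi>) ! Suc i)
       else below_via f ((C # \<Phi>) ! i) ((C # \<Phi>) ! Suc i)))"
      by (auto simp: cong nth_Cons')
    also have "\<dots> \<longleftrightarrow> (\<forall>X\<in>set (B # C # \<Phi>). constant_over f X) \<and>
    (\<forall>i. Suc i < length (B # C # \<Phi>) \<longrightarrow>
      (if k + i \<in> I then constant_over f ((B # C # \<Phi>) ! i \<union> (B # C # \<Phi>) ! Suc i)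
       else below_via f ((B # C # \<Phi>) ! i) ((B # C # \<Phi>) ! Suc i)))"
      \<comment> \<open>Splits off the pair \<open>(B, C)\<close>, whose condition is constancy on
        \<open>B \<union> C\<close>, and shifts the other indices by one.\<close>
      unfolding list.size add_0_right add_Suc_right add_0 all_Suc_less_Suc
      using True const by auto
    finally show ?thesis .
  next
    case False
    obtain D \<Psi> where D: "merge_at (Suc k) I (C # \<Phi>) = D # \<Psi>" "C \<subseteq> D"
      using merge_at_Cons by metis
    have "C \<noteq> {}" using 3 by auto
    \<comment> \<open>The value of a constant \<open>D\<close> can be read off on its nonempty
      subset \<open>C\<close>.\<close>
    then have "below_via f B D \<longleftrightarrow> below_via f B C" if "constant_over f D"
      using that D(2) unfolding below_via_def constant_over_def by (metis all_not_in_conv subset_iff)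
    then have "strata f (merge_at k I (B # C # \<Phi>)) \<longleftrightarrow>
        constant_over f B \<and> below_via f B C \<and> strata f (merge_at (Suc k) I (C # \<Phi>))"
      using False D by (auto simp: strata_def)
    moreover have "strata f (merge_at (Suc k) I (C # \<Phi>)) \<longleftrightarrow> (\<forall>B\<in>set (C # \<Phi>). constant_over f B) \<and>
      (\<forall>i. Suc i < length (C # \<Phi>) \<longrightarrow>
      (if Suc k + i \<in> I then constant_over f ((C # \<Phi>) ! i \<union> (C # \<Phi>) ! Suc i)
       else below_via f ((C # \<Phi>) ! i) ((C # \<Phi>) ! Suc i)))"
      by (rule "3.IH"(2)[OF False]) (use "3.prems" in auto)
    ultimately show ?thesis
      unfolding list.size add_0_right add_Suc_right add_0 all_Suc_less_Suc
      using False by auto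
  qed
qed (auto simp: strata_def)

section \<open>The fibres of a word as a set composition\<close>

definition fibre_list :: "nat \<Rightarrow> nat list \<Rightarrow> nat set list" where
  "fibre_list n w = map (\<lambda>a. {i \<in> {1..n}. w ! (i - 1) = a}) (sorted_list_of_set (set w))"

lemma set_conv_letters: "length w = n \<Longrightarrow> set w = (\<lambda>i. w ! (i - 1)) ` {1..n}"
  unfolding One_nat_def image_Suc_lessThan[symmetric, simplified] by (auto simp: set_conv_nth image_image)

lemma M_nc_conv_fibre_list: "M_nc n \<Psi> w = of_bool (w \<in> words n \<and> \<Psi> = fibre_list n w)"
  unfolding M_nc_def fibre_list_def by (rule arg_cong[where f = of_bool]) (auto simp: list_eq_iff_nth_eq)

text \<open>For the converse, the values of successive blocks increase strictly and exhaust the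
  letters of \<open>w\<close>, so they are its sorted letters, and each block is the full fibre of
  its value.\<close>

lemma fibre_list_iff_strata:
  assumes len: "length w = n" and U: "\<Union>(set \<Psi>) = {1..n}" and ne: "{} \<notin> set \<Psi>"
  shows "\<Psi> = fibre_list n w \<longleftrightarrow> strata (\<lambda>i. w ! (i - 1)) \<Psi>"
proof
  assume "\<Psi> = fibre_list n w"
  moreover have "successively (<) (sorted_list_of_set (set w))"
    by (simp add: successively_conv_sorted_wrt[OF transp_on_less])
  ultimately show "strata (\<lambda>i. w ! (i - 1)) \<Psi>"
    by (auto simp: strata_def fibre_list_def constant_over_def below_via_def successively_map
        elim!: successively_mono)
next
  let ?f = "\<lambda>i. w ! (i - 1)" and ?v = "\<lambda>B. w ! (Min B - 1)"
  assume st: "strata ?f \<Psi>"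
  have B: "Min B \<in> B" "B \<subseteq> {1..n}" if "B \<in> set \<Psi>" for B
    using that ne U by (metis Min_in Union_upper finite_atLeastAtMost finite_subset, blast)
  have val: "?f i = ?v B" if "B \<in> set \<Psi>" "i \<in> B" for B i
    using st that B unfolding strata_def constant_over_def by blast
  have "successively (<) (map ?v \<Psi>)"
    unfolding successively_map
    by (rule successively_mono[of "below_via ?f"])
      (use st B in \<open>auto simp: strata_def below_via_def\<close>)
  then have sorted: "sorted_wrt (<) (map ?v \<Psi>)"
    by (simp add: successively_conv_sorted_wrt[OF transp_on_less])
  have "set (map ?v \<Psi>) = ?f ` \<Union>(set \<Psi>)"
  proof (intro equalityI subsetI)
    fix a assume "a \<in> set (map ?v \<Psi>)"
    then obtain C where "C \<in> set \<Psi>" "a = ?v C"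
      by auto
    then show "a \<in> ?f ` \<Union>(set \<Psi>)"
      using B(1) by blast
  next
    fix a assume "a \<in> ?f ` \<Union>(set \<Psi>)"
    then obtain C i where "C \<in> set \<Psi>" "i \<in> C" "a = ?f i"
      by blast
    then show "a \<in> set (map ?v \<Psi>)"
      using val by auto
  qed
  \<comment> \<open>A strictly increasing list is determined by its set.\<close>
  then have letters: "map ?v \<Psi> = sorted_list_of_set (set w)"
    using U sorted set_conv_letters[OF len]
    by (metis sorted_list_of_set.idem_if_sorted_distinct strict_sorted_iff)
  have "fibre_list n w = map (\<lambda>B. {i \<in> {1..n}. ?f i = ?v B}) \<Psi>"
    unfolding fibre_list_def letters[symmetric] by (simp add: comp_def)
  moreover have "{i \<in> {1..n}. ?f i = ?v B} = B" if "B \<in> set \<Psi>" for B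
  proof -
    \<comment> \<open>Any position with the value of \<open>B\<close> lies in some block of equal
      value, which injectivity identifies with \<open>B\<close>.\<close>
    have "inj_on ?v (set \<Psi>)"
      using sorted by (simp add: strict_sorted_iff distinct_map)
    show ?thesis
    proof (intro equalityI subsetI)
      fix i assume i: "i \<in> {i \<in> {1..n}. ?f i = ?v B}"
      then obtain C where C: "C \<in> set \<Psi>" "i \<in> C"
        using U by blast
      then have "?v C = ?v B"
        using i val by simp
      then show "i \<in> B"
        using \<open>inj_on ?v (set \<Psi>)\<close> C that by (metis inj_onD)
    next
      fix i assume "i \<in> B"
      then show "i \<in> {i \<in> {1..n}. ?f i = ?v B}"
        using that val B(2) by blast
    qed
  qed
  ultimately show "\<Psi> = fibre_list n w"
    by (simp add: map_idI)
qed

section \<open>The order on blocks and the coefficients of \<open>P_nc\<close>\<close>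

text \<open>
  The truncated subtraction is harmless for blocks contained in \<open>{1..n}\<close>; it reverses the order
  of cardinalities, so that \<open>gt_D\<close> corresponds to the increasing order of the last two components.
\<close>

definition block_key :: "nat \<Rightarrow> nat list \<Rightarrow> nat set \<Rightarrow> nat \<times> nat \<times> nat" where
  "block_key n w B = (w ! (Min B - 1), n - card B, Min B)"

text \<open>Distinct blocks are disjoint, so their minima already differ.\<close>

lemma inj_on_block_key:
  assumes "partition_on {1..n} \<phi>"
  shows "inj_on (block_key n w) \<phi>"
proof (rule inj_onI)
  fix B C assume BC: "B \<in> \<phi>" "C \<in> \<phi>" "block_key n w B = block_key n w C"
  have min: "Min X \<in> X" if "X \<in> \<phi>" for X
    using that assms by (metis Min_in finite_atLeastAtMost finite_elements finite_subset
        partition_onD1 partition_onD3 Union_upper)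
  have "Min B = Min C"
    using BC by (simp add: block_key_def)
  then have "B \<inter> C \<noteq> {}"
    using min BC by (metis disjoint_iff)
  with BC show "B = C"
    using assms by (metis disjointD partition_onD2)
qed

text \<open>For constant blocks, an adjacent pair has an increasing key if and only if it may stay
  separate (the letter rises) or may be merged (equal letters at a descent).\<close>

lemma fibre_list_in_mergings_iff:
  assumes len: "length w = n" and \<Phi>: "set_composition n \<Phi>"
  shows "fibre_list n w \<in> {merge_at 0 I \<Phi> | I. I \<subseteq> descents_D \<Phi>} \<longleftrightarrow>
    (\<forall>B\<in>set \<Phi>. constant_over (\<lambda>i. w ! (i - 1)) B) \<and> sorted_wrt (<) (map (block_key n w) \<Phi>)"
    (is "?L \<longleftrightarrow> ?C \<and> ?S")
proof -
  let ?f = "\<lambda>i. w ! (i - 1)"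
  have part: "partition_on {1..n} (set \<Phi>)"
    using \<Phi> by (simp add: set_composition_def)
  have U: "\<Union>(set \<Phi>) = {1..n}" and ne: "{} \<notin> set \<Phi>"
    using part by (auto simp: partition_on_def)
  have block: "Min B \<in> B" "card B \<le> n" if "B \<in> set \<Phi>" for B
  proof -
    have "B \<subseteq> {1..n}" "B \<noteq> {}" using that U ne by auto
    then show "Min B \<in> B" "card B \<le> n"
      using finite_subset[of B "{1..n}"] Min_in[of B] card_mono[of "{1..n}" B] by auto
  qed
  have merge: "fibre_list n w = merge_at 0 I \<Phi> \<longleftrightarrow> ?C \<and> (\<forall>i. Suc i < length \<Phi> \<longrightarrow>
      (if i \<in> I then constant_over ?f (\<Phi> ! i \<union> \<Phi> ! Suc i)
       else below_via ?f (\<Phi> ! i) (\<Phi> ! Suc i)))" for I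
  proof -
    have "merge_at 0 I \<Phi> = fibre_list n w \<longleftrightarrow> strata ?f (merge_at 0 I \<Phi>)"
      by (rule fibre_list_iff_strata[OF len])
        (simp_all add: Union_merge_at U empty_notin_merge_at ne)
    then show ?thesis
      by (simp only: eq_commute[of "fibre_list n w"] strata_merge_at[OF ne] add_0)
  qed
  have key: "block_key n w B < block_key n w C \<longleftrightarrow>
      below_via ?f B C \<or> constant_over ?f (B \<union> C) \<and> gt_D B C"
    and excl: "\<not> (below_via ?f B C \<and> constant_over ?f (B \<union> C))"
    if "B \<in> set \<Phi>" "C \<in> set \<Phi>" ?C for B C
  proof -
    have f: "\<forall>x\<in>B. ?f x = ?f (Min B)" "\<forall>x\<in>C. ?f x = ?f (Min C)"
      using that block unfolding constant_over_def by blast+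
    have "below_via ?f B C \<longleftrightarrow> ?f (Min B) < ?f (Min C)"
      using f block that unfolding below_via_def by metis
    moreover have "constant_over ?f (B \<union> C) \<longleftrightarrow> ?f (Min B) = ?f (Min C)"
      using f block that unfolding constant_over_def by (metis Un_iff)
    moreover have "gt_D B C \<longleftrightarrow> (n - card B, Min B) < (n - card C, Min C)"
      using block(2)[OF that(1)] block(2)[OF that(2)] unfolding gt_D_def less_prod_simp by arith
    ultimately show "block_key n w B < block_key n w C \<longleftrightarrow>
      below_via ?f B C \<or> constant_over ?f (B \<union> C) \<and> gt_D B C"
      "\<not> (below_via ?f B C \<and> constant_over ?f (B \<union> C))"
      by (auto simp: block_key_def)
  qed
  \<comment> \<open>Transitivity reduces sortedness to adjacent pairs, matching the form of
    \<open>merge\<close>.\<close>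
  have S: "?S \<longleftrightarrow> (\<forall>i. Suc i < length \<Phi> \<longrightarrow>
      block_key n w (\<Phi> ! i) < block_key n w (\<Phi> ! Suc i))"
    by (simp add: successively_conv_nth successively_conv_sorted_wrt[OF transp_on_less, symmetric])
  show ?thesis
  proof
    assume ?L
    then show "?C \<and> ?S"
      unfolding S using key by (fastforce simp: merge descents_D_def split: if_splits)
  next
    assume CS: "?C \<and> ?S"
    \<comment> \<open>All descents with equal letters are merged; by \<open>key\<close>, the letter
      rises at every other adjacent pair.\<close>
    define I where "I = {i \<in> descents_D \<Phi>. constant_over ?f (\<Phi> ! i \<union> \<Phi> ! Suc i)}"
    have "fibre_list n w = merge_at 0 I \<Phi>"
      unfolding merge
      using CS key unfolding S by (auto simp: I_def descents_D_def)
    then show ?L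
      by (auto simp: I_def)
  qed
qed

section \<open>Refinement and the coefficients of \<open>m_nc\<close>\<close>

lemma refines_fibres_iff:
  assumes len: "length w = n" and \<phi>: "partition_on {1..n} \<phi>"
  shows "refines_partition \<phi> (set (fibre_list n w)) \<longleftrightarrow>
    (\<forall>B\<in>\<phi>. constant_over (\<lambda>i. w ! (i - 1)) B)"
proof -
  let ?f = "\<lambda>i. w ! (i - 1)"
  have U: "\<Union>\<phi> = {1..n}" and disj: "\<And>B C. B \<in> \<phi> \<Longrightarrow> C \<in> \<phi> \<Longrightarrow> B \<inter> C \<noteq> {} \<Longrightarrow> B = C"
    using \<phi> by (auto simp: partition_on_def disjoint_def)
  have fib: "set (fibre_list n w) = (\<lambda>a. {i \<in> {1..n}. ?f i = a}) ` ?f ` {1..n}"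
    by (simp only: fibre_list_def set_map set_sorted_list_of_set[OF finite_set])
      (simp only: set_conv_letters[OF len])
  show ?thesis
  proof
    assume ref: "refines_partition \<phi> (set (fibre_list n w))"
    show "\<forall>B\<in>\<phi>. constant_over ?f B"
      unfolding constant_over_def
    proof (intro ballI)
      fix B x y assume *: "B \<in> \<phi>" "x \<in> B" "y \<in> B"
      then have x: "x \<in> {1..n}" using U by blast
      then obtain S where S: "S \<subseteq> \<phi>" "{i \<in> {1..n}. ?f i = ?f x} = \<Union>S"
        using ref unfolding refines_partition_def fib by blast
      then obtain C where "C \<in> S" "x \<in> C" using x by blast
      \<comment> \<open>The block through \<open>x\<close> is unique, so \<open>B\<close> is one of
        the blocks composing the fibre of \<open>x\<close>.\<close>
      then have "C = B" using disj * S by blast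
      then have "y \<in> \<Union>S" using \<open>C \<in> S\<close> * by blast
      then show "?f x = ?f y" unfolding S(2)[symmetric] by simp
    qed
  next
    assume const: "\<forall>B\<in>\<phi>. constant_over ?f B"
    \<comment> \<open>The witness for refinement: a fibre is the union of the blocks on which
      \<open>w\<close> takes its letter.\<close>
    have eq: "{i \<in> {1..n}. ?f i = a} = \<Union>{B \<in> \<phi>. \<forall>i\<in>B. ?f i = a}" for a
    proof (intro equalityI subsetI)
      fix i assume i: "i \<in> {i \<in> {1..n}. ?f i = a}"
      then obtain B where B: "B \<in> \<phi>" "i \<in> B"
        using U by blast
      then have "constant_over ?f B"
        using const by blast
      then have "?f j = a" if "j \<in> B" for j
        using constant_overD[OF _ that B(2), of ?f] i by simp
      then show "i \<in> \<Union>{B \<in> \<phi>. \<forall>i\<in>B. ?f i = a}"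
        using B by (intro UnionI[of B] CollectI conjI ballI)
    next
      fix i assume "i \<in> \<Union>{B \<in> \<phi>. \<forall>i\<in>B. ?f i = a}"
      then show "i \<in> {i \<in> {1..n}. ?f i = a}"
        using U by blast
    qed
    show "refines_partition \<phi> (set (fibre_list n w))"
      unfolding refines_partition_def fib
    proof
      fix X assume "X \<in> (\<lambda>a. {i \<in> {1..n}. ?f i = a}) ` ?f ` {1..n}"
      then obtain a where "X = {i \<in> {1..n}. ?f i = a}"
        by auto
      then show "\<exists>S\<subseteq>\<phi>. X = \<Union>S"
        unfolding eq by (intro exI[of _ "{B \<in> \<phi>. \<forall>i\<in>B. ?f i = a}"]) auto
    qed
  qed
qed

lemma partition_on_fibres:
  assumes "length w = n"
  shows "partition_on {1..n} (set (fibre_list n w))"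
  unfolding fibre_list_def set_map set_sorted_list_of_set[OF finite_set] set_conv_letters[OF assms]
  by (rule partition_onI) (auto simp: disjnt_def)

text \<open>A partition is determined by its relation of lying in a common block, and for the fibres
  this relation is equality of letters.\<close>

lemma m_nc_conv_fibres:
  assumes \<psi>: "partition_on {1..n} \<psi>"
  shows "m_nc n \<psi> w = of_bool (w \<in> words n \<and> \<psi> = set (fibre_list n w))"
proof -
  let ?f = "\<lambda>i. w ! (i - 1)"
  have "(\<forall>j\<in>{1..n}. \<forall>j'\<in>{1..n}. ?f j = ?f j' \<longleftrightarrow> (\<exists>B\<in>\<psi>. j \<in> B \<and> j' \<in> B)) \<longleftrightarrow>
      \<psi> = set (fibre_list n w)" (is "?L \<longleftrightarrow> _") if len: "length w = n"
  proof -
    let ?\<chi> = "set (fibre_list n w)"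
    have rel: "?f j = ?f j' \<longleftrightarrow> (\<exists>B\<in>?\<chi>. j \<in> B \<and> j' \<in> B)" if "j \<in> {1..n}" "j' \<in> {1..n}" for j j'
      using that by (auto simp: fibre_list_def set_conv_letters[OF len])
    \<comment> \<open>Stated for two arbitrary partitions, so that exchanging them gives both
      inclusions.\<close>
    have sub: "\<chi>1 \<subseteq> \<chi>2" if p: "partition_on {1..n} \<chi>1" "partition_on {1..n} \<chi>2"
      and eq: "\<forall>j\<in>{1..n}. \<forall>j'\<in>{1..n}. (\<exists>B\<in>\<chi>1. j \<in> B \<and> j' \<in> B) \<longleftrightarrow> (\<exists>B\<in>\<chi>2. j \<in> B \<and> j' \<in> B)"
      for \<chi>1 \<chi>2 :: "nat set set"
    proof
      fix B assume B: "B \<in> \<chi>1"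
      then have "B \<noteq> {}" "B \<subseteq> {1..n}"
        using p by (auto simp: partition_on_def)
      then obtain x where x: "x \<in> B" "x \<in> {1..n}"
        by blast
      then obtain C where C: "C \<in> \<chi>2" "x \<in> C"
        using p(2) by (metis UnionE partition_onD1)
      have sub: "B \<subseteq> {1..n}" "C \<subseteq> {1..n}" using B C p by (auto simp: partition_on_def)
      have d: "X \<in> \<chi> \<Longrightarrow> Y \<in> \<chi> \<Longrightarrow> z \<in> X \<Longrightarrow> z \<in> Y \<Longrightarrow> X = Y" if "partition_on {1..n} \<chi>" for \<chi> X Y z
        using that by (auto simp: partition_on_def disjoint_def)
      have "B = C"
        using eq x B C sub d[OF p(1)] d[OF p(2)] by blast
      then show "B \<in> \<chi>2" using C by simp
    qed
    show ?thesis
      using sub[OF \<psi> partition_on_fibres[OF len]] sub[OF partition_on_fibres[OF len] \<psi>] rel by auto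
  qed
  then show ?thesis
    unfolding m_nc_def by (intro arg_cong[where f = of_bool]) (auto simp: words_def)
qed

section \<open>Comparison of coefficients\<close>

lemma sum_fun_apply: "sum F A x = (\<Sum>a\<in>A. F a x)" for F :: "'a \<Rightarrow> 'b \<Rightarrow> 'c::comm_monoid_add"
  by (induction A rule: infinite_finite_induct) auto

theorem theorem8:
  fixes n :: nat and \<phi> :: "nat set set"
  assumes "partition_on {1..n} \<phi>"
  shows "(p_nc n \<phi> :: 'r::comm_ring_1 ncseries) =
    (\<Sum>\<Phi> \<in> {\<Phi>. set_composition n \<Phi> \<and> set \<Phi> = \<phi>}. P_nc n \<Phi>)"
proof
  fix w :: "nat list"
  let ?C = "\<forall>B\<in>\<phi>. constant_over (\<lambda>i. w ! (i - 1)) B"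
  have p: "p_nc n \<phi> w = (of_bool (w \<in> words n \<and> ?C) :: 'r)"
  proof -
    have "p_nc n \<phi> w = (\<Sum>\<psi> \<in> {\<psi>. partition_on {1..n} \<psi> \<and> refines_partition \<phi> \<psi>}.
        if set (fibre_list n w) = \<psi> then of_bool (w \<in> words n) else 0 :: 'r)"
      unfolding p_nc_def sum_fun_apply by (rule sum.cong) (auto simp: m_nc_conv_fibres)
    \<comment> \<open>Only the fibre partition can contribute, and it belongs to the index set
      exactly when it is coarser than \<phi>.\<close>
    also have "\<dots> = of_bool (w \<in> words n \<and> ?C)"
      using partition_on_fibres refines_fibres_iff[OF _ assms]
      by (subst sum.delta'[OF finite_coarser_partitions]) (auto simp: words_def)
    finally show ?thesis .
  qed
  have P: "P_nc n \<Phi> w = (of_bool (w \<in> words n \<and> ?C \<and> sorted_wrt (<) (map (block_key n w) \<Phi>)) :: 'r)"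
    if "set_composition n \<Phi>" "set \<Phi> = \<phi>" for \<Phi>
  proof -
    have "P_nc n \<Phi> w = (\<Sum>\<Psi> \<in> {merge_at 0 I \<Phi> | I. I \<subseteq> descents_D \<Phi>}.
        if fibre_list n w = \<Psi> then of_bool (w \<in> words n) else 0 :: 'r)"
      unfolding P_nc_def sum_fun_apply by (rule sum.cong) (auto simp: M_nc_conv_fibre_list)
    also have "\<dots> = of_bool (w \<in> words n \<and> fibre_list n w \<in> {merge_at 0 I \<Phi> | I. I \<subseteq> descents_D \<Phi>})"
      by (subst sum.delta'[OF finite_mergings]) auto
    also have "\<dots> = of_bool (w \<in> words n \<and> ?C \<and> sorted_wrt (<) (map (block_key n w) \<Phi>))"
      using fibre_list_in_mergings_iff[OF _ that(1), of w] that(2)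
      by (intro arg_cong[where f = of_bool]) (auto simp: words_def)
    finally show ?thesis .
  qed
  have fin: "finite \<phi>"
    using finite_elements[OF _ assms] by simp
  \<comment> \<open>Sorting by an injective key: \<phi> has exactly one arrangement with strictly
    increasing keys.\<close>
  interpret folding_insort_key "(\<le>)" "(<)" \<phi> "block_key n w"
    by unfold_locales (rule inj_on_block_key[OF assms])
  obtain \<Phi>\<^sub>0 where "\<And>\<Phi>. sorted_wrt (<) (map (block_key n w) \<Phi>) \<and> set \<Phi> = \<phi> \<and>
      length \<Phi> = card \<phi> \<longleftrightarrow> \<Phi>\<^sub>0 = \<Phi>"
    using sorted_key_list_of_set_unique[OF subset_refl fin] by blast
  \<comment> \<open>For a list with set \<phi>, having length \<open>card \<phi>\<close> amounts to
    distinctness.\<close>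
  then have comp: "set_composition n \<Phi> \<and> set \<Phi> = \<phi> \<and> sorted_wrt (<) (map (block_key n w) \<Phi>)
      \<longleftrightarrow> \<Phi>\<^sub>0 = \<Phi>" for \<Phi>
    using assms unfolding set_composition_def by (metis card_distinct distinct_card)
  have "(\<Sum>\<Phi> \<in> {\<Phi>. set_composition n \<Phi> \<and> set \<Phi> = \<phi>}. P_nc n \<Phi>) w
      = (\<Sum>\<Phi> \<in> {\<Phi>. set_composition n \<Phi> \<and> set \<Phi> = \<phi>}.
          if \<Phi>\<^sub>0 = \<Phi> then of_bool (w \<in> words n \<and> ?C) else 0 :: 'r)"
    unfolding sum_fun_apply by (rule sum.cong) (use P comp in auto)
  also have "\<dots> = of_bool (w \<in> words n \<and> ?C)"
    using comp[of \<Phi>\<^sub>0] by (simp add: sum.delta'[OF finite_set_compositions])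
  finally show "(p_nc n \<phi> w :: 'r) = (\<Sum>\<Phi> \<in> {\<Phi>. set_composition n \<Phi> \<and> set \<Phi> = \<phi>}. P_nc n \<Phi>) w"
    using p by simp
qed

end
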